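(* For each $n\ge1$, $$\sum_{\pi\in\mathfrak S_{2n}}t^{\mathrm{exc}(\pi)}y^{\mathrm{fix}(\pi)}=\sum_{\pi\in\mathfrak S_{2n}}t^{\mathrm{exph}(\pi)}y^{\mathrm{fix}(\pi)}.$$
   Context: $\mathfrak S_{2n}$ is the set of permutations of $[2n]$. $\mathrm{exc}(\pi)=\#\{i:\pi(i)>i\}$, $\mathrm{fix}(\pi)=\#\{i:\pi(i)=i\}$. For $\pi\in\mathfrak S_{2n}$, an index $i\in[2n]$ is counted by $\mathrm{exph}(\pi)$ if it satisfies one of: (I) $1\le i<\pi(i)\le n$; (II) $n+1\le i\le 2n$ and $i-n\le\pi(i)\le n$; (III) $n+1\le i<\pi(i)\le 2n$; (IV) $1\le i<\pi(i)-n$ and $n+1\le\pi(i)\le 2n$. $t,y$ are indeterminates. *)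

theory Defs
  imports "HOL-Combinatorics.Permutations" "HOL-Computational_Algebra.Polynomial"
begin

definition exc :: "nat \<Rightarrow> (nat \<Rightarrow> nat) \<Rightarrow> nat" where
  "exc m p = card {i \<in> {1..m}. p i > i}"

(* A function that permutes {1..m} is the identity elsewhere, so the fixed points
   have to be restricted to {1..m}. *)
definition fixp :: "nat \<Rightarrow> (nat \<Rightarrow> nat) \<Rightarrow> nat" where
  "fixp m p = card {i \<in> {1..m}. p i = i}"

(* The subtractions on nat do not truncate: each occurs together with a bound
   n + 1 \<le> i or n + 1 \<le> p i. *)
definition exph :: "nat \<Rightarrow> (nat \<Rightarrow> nat) \<Rightarrow> nat" where
  "exph n p = card {i \<in> {1..2 * n}.
     (1 \<le> i \<and> i < p i \<and> p i \<le> n) \<or>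
     (n + 1 \<le> i \<and> i \<le> 2 * n \<and> i - n \<le> p i \<and> p i \<le> n) \<or>
     (n + 1 \<le> i \<and> i < p i \<and> p i \<le> 2 * n) \<or>
     (1 \<le> i \<and> i < p i - n \<and> n + 1 \<le> p i \<and> p i \<le> 2 * n)}"

(* Z[t,y] is represented as Z[t][y]: the indeterminate t is the constant polynomial
   in y whose value is the indeterminate of the coefficient ring Z[t]. *)
definition indet_t :: "int poly poly" where
  "indet_t = [:[:0, 1:]:]"

definition indet_y :: "int poly poly" where
  "indet_y = [:0, 1:]"

end

(* Order [2n] as n+1, 1, n+2, 2, ..., 2n, n, and let s i be the rank of i in this order.
   Conditions (I)-(IV) together say exactly that s i < s (p i), so exph n p is the number of
   excedances of the conjugate of p by s. Conjugation is a bijection on permutations that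
   preserves the number of fixed points. *)
theory Submission
  imports Defs
begin

text \<open>Substitute \<open>k = s i\<close>. Keeping \<open>R\<close> arbitrary serves both
  statistics: strict order counts excedances, equality counts fixed points.\<close>

lemma card_conj_by_permutation:
  assumes s: "s permutes A"
  shows "card {k \<in> A. R k ((s \<circ> p \<circ> inv s) k)} = card {i \<in> A. R (s i) (s (p i))}"
proof -
  have "{k \<in> A. R k ((s \<circ> p \<circ> inv s) k)} = s ` {i \<in> A. R (s i) (s (p i))}" (is "?K = s ` ?I")
  proof
    show "?K \<subseteq> s ` ?I"
    proof
      fix k assume k: "k \<in> ?K"
      then have "inv s k \<in> ?I"
        using permutes_in_image[OF permutes_inv[OF s]] permutes_inverses[OF s] by auto
      then show "k \<in> s ` ?I"
        using permutes_inverses(1)[OF s, of k] by (metis imageI)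
    qed
    show "s ` ?I \<subseteq> ?K"
      using permutes_in_image[OF s] permutes_inverses[OF s] by auto
  qed
  moreover have "inj_on s ?I"
    using permutes_inj[OF s] inj_on_subset by blast
  ultimately show ?thesis
    by (simp add: card_image)
qed

lemma sum_permutes_conj:
  assumes s: "s permutes A"
  shows "(\<Sum>p | p permutes A. f p) = (\<Sum>p | p permutes A. f (s \<circ> p \<circ> inv s))"
proof (rule sum.reindex_bij_witness[where i = "\<lambda>p. s \<circ> p \<circ> inv s" and j = "\<lambda>p. inv s \<circ> p \<circ> s"])
  fix p assume "p \<in> {p. p permutes A}"
  then have p: "p permutes A" by simp
  show "s \<circ> (inv s \<circ> p \<circ> s) \<circ> inv s = p" "inv s \<circ> (s \<circ> p \<circ> inv s) \<circ> s = p"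
    using permutes_inverses[OF s] by (auto simp: fun_eq_iff)
  then show "f (s \<circ> (inv s \<circ> p \<circ> s) \<circ> inv s) = f p"
    by simp
  show "inv s \<circ> p \<circ> s \<in> {p. p permutes A}" "s \<circ> p \<circ> inv s \<in> {p. p permutes A}"
    using p s permutes_inv[OF s] by (auto intro!: permutes_compose)
qed

text \<open>The identity branch is there because \<open>permutes\<close> demands it outside
  \<open>{1..2 * n}\<close>.\<close>

definition shuffle_rank :: "nat \<Rightarrow> nat \<Rightarrow> nat" where
  "shuffle_rank n i =
     (if i \<in> {1..n} then 2 * i else if i \<in> {n + 1..2 * n} then 2 * (i - n) - 1 else i)"

lemma shuffle_rank_permutes: "shuffle_rank n permutes {1..2 * n}"
proof (rule inj_imp_permutes)
  show "inj_on (shuffle_rank n) {1..2 * n}"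
    \<comment> \<open>Parity separates the halves: \<open>1..n\<close> gets the even ranks,
      \<open>n + 1..2 * n\<close> the odd ones.\<close>
    by (rule inj_onI) (auto simp: shuffle_rank_def split: if_splits; presburger)
qed (auto simp: shuffle_rank_def)

text \<open>Each of (I)-(IV) is one choice of halves for \<open>i\<close> and \<open>p i\<close>.
  The odd offset explains the weak inequality in (II) and the strict one in (IV):
  \<open>2 * a - 1 < 2 * b\<close> iff \<open>a \<le> b\<close>, while
  \<open>2 * a < 2 * b - 1\<close> iff \<open>a < b\<close>.\<close>

lemma exph_eq_exc_conj:
  assumes p: "p permutes {1..2 * n}"
  shows "exph n p = exc (2 * n) (shuffle_rank n \<circ> p \<circ> inv (shuffle_rank n))"
proof -
  have "((1 \<le> i \<and> i < p i \<and> p i \<le> n) \<or>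
     (n + 1 \<le> i \<and> i \<le> 2 * n \<and> i - n \<le> p i \<and> p i \<le> n) \<or>
     (n + 1 \<le> i \<and> i < p i \<and> p i \<le> 2 * n) \<or>
     (1 \<le> i \<and> i < p i - n \<and> n + 1 \<le> p i \<and> p i \<le> 2 * n)) \<longleftrightarrow>
     shuffle_rank n i < shuffle_rank n (p i)" if i: "i \<in> {1..2 * n}" for i
  proof -
    have "p i \<in> {1..2 * n}"
      using i permutes_in_image[OF p] by blast
    with i show ?thesis
      unfolding shuffle_rank_def atLeastAtMost_iff by (simp split: if_split) arith
  qed
  then show ?thesis
    unfolding exph_def exc_def
      card_conj_by_permutation[OF shuffle_rank_permutes, where R = "\<lambda>k l. k < l"]
    by (intro arg_cong[where f = card] Collect_cong) blast
qed

lemma fixp_conj: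
  assumes "s permutes {1..m}"
  shows "fixp m (s \<circ> p \<circ> inv s) = fixp m p"
  \<comment> \<open>The count is now of \<open>s (p i) = s i\<close>, and injectivity cancels
    \<open>s\<close>.\<close>
  unfolding fixp_def card_conj_by_permutation[OF assms, where R = "\<lambda>k l. l = k"]
  using permutes_inj[OF assms] by (simp add: inj_eq)

theorem theorem3p8:
  fixes n :: nat
  assumes "n \<ge> 1"
  shows "(\<Sum>p | p permutes {1..2 * n}. indet_t ^ exc (2 * n) p * indet_y ^ fixp (2 * n) p)
       = (\<Sum>p | p permutes {1..2 * n}. indet_t ^ exph n p * indet_y ^ fixp (2 * n) p)"
  \<comment> \<open>After conjugation in the sum over \<open>exc\<close>, both sums agree term by
    term.\<close>
  by (subst sum_permutes_conj[OF shuffle_rank_permutes])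
    (simp add: exph_eq_exc_conj fixp_conj[OF shuffle_rank_permutes])

end
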